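(* Let $G$ be the simply connected 4-dimensional Lie group whose Lie algebra has a basis $X_1,X_2,X_3,X_4$ with $$[X_2,X_3]=[X_3,X_1]=[X_1,X_2]=0,\quad [X_1,X_4]=-\tfrac12X_1+X_2,\quad [X_2,X_4]=-\tfrac12X_2,\quad [X_3,X_4]=X_3 .$$ For real numbers $a_1,\dots,a_6$ let $$Y_1=X_1+a_2X_2+a_3X_3,\quad Y_2=X_2+a_1X_3,\quad Y_3=X_3,\quad Y_4=a_4X_1+a_5X_2+a_6X_3+X_4 .$$ Suppose the left-invariant metric $g_0$ on $G$ is diagonal in the basis $Y_i$, i.e. $g_0(Y_i,Y_j)=\lambda_i\delta_{ij}$ with $\lambda_i>0$. Then the Ricci flow solution $g(t)$ with $g(0)=g_0$ remains diagonal in the basis $Y_i$ if and only if $a_1=a_3=0$.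
   Context: Elements of the Lie algebra are identified with left-invariant vector fields on $G$. The Ricci flow solution $g(t)$ is the left-invariant solution of $\frac{\partial}{\partial t}g(t)=-2\operatorname{Ric}(g(t))$, $g(0)=g_0$ (equivalently, the solution of the corresponding ODE on inner products on the Lie algebra). "$g(t)$ remains diagonal in the basis $Y_i$" means $g(t)(Y_i,Y_j)=0$ for all $i\ne j$ and all $t\ge0$ in its maximal interval of existence. *)

theory Defs
  imports "HOL-Analysis.Analysis"
begin

definition is_basis :: "'a::real_vector set \<Rightarrow> bool" where
  "is_basis B \<longleftrightarrow> finite B \<and> independent B \<and> span B = UNIV"

text \<open>The trace of an endomorphism of a finite-dimensional space. The value does not depend on
  the chosen basis, see \<open>lin_trace_eq\<close> below.\<close>

definition lin_trace :: "('a::real_vector \<Rightarrow> 'a) \<Rightarrow> real" where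
  "lin_trace f = (let B = (SOME B. is_basis B) in \<Sum>b\<in>B. representation B (f b) b)"

definition lie_bracket :: "('a::real_vector \<Rightarrow> 'a \<Rightarrow> 'a) \<Rightarrow> bool" where
  "lie_bracket br \<longleftrightarrow> bilinear br \<and> (\<forall>x. br x x = 0) \<and>
     (\<forall>x y z. br x (br y z) + br y (br z x) + br z (br x y) = 0)"

definition inner_product :: "('a::real_vector \<Rightarrow> 'a \<Rightarrow> real) \<Rightarrow> bool" where
  "inner_product g \<longleftrightarrow> bilinear g \<and> (\<forall>x y. g x y = g y x) \<and> (\<forall>x. x \<noteq> 0 \<longrightarrow> g x x > 0)"

text \<open>A left-invariant metric on a Lie group is an inner product \<open>g\<close> on the Lie algebra of
  left-invariant vector fields. Its Levi-Civita connection maps left-invariant fields to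
  left-invariant fields. For such fields \<open>g y z\<close> is a constant function on the group, so that
  metric compatibility \<open>x (g y z) = g (D x y) z + g y (D x z)\<close> has left-hand side \<open>0\<close>.\<close>

definition is_levi_civita ::
  "('a::real_vector \<Rightarrow> 'a \<Rightarrow> 'a) \<Rightarrow> ('a \<Rightarrow> 'a \<Rightarrow> real) \<Rightarrow> ('a \<Rightarrow> 'a \<Rightarrow> 'a) \<Rightarrow> bool" where
  "is_levi_civita br g D \<longleftrightarrow> bilinear D \<and>
     (\<forall>x y. D x y - D y x = br x y) \<and>
     (\<forall>x y z. g (D x y) z + g y (D x z) = 0)"

text \<open>The description is proper whenever \<open>g\<close> is an inner product on a finite-dimensional Lie
  algebra, see \<open>ex1_levi_civita\<close> below.\<close>

definition levi_civita ::
  "('a::real_vector \<Rightarrow> 'a \<Rightarrow> 'a) \<Rightarrow> ('a \<Rightarrow> 'a \<Rightarrow> real) \<Rightarrow> 'a \<Rightarrow> 'a \<Rightarrow> 'a" where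
  "levi_civita br g = (THE D. is_levi_civita br g D)"

definition riemann ::
  "('a::real_vector \<Rightarrow> 'a \<Rightarrow> 'a) \<Rightarrow> ('a \<Rightarrow> 'a \<Rightarrow> real) \<Rightarrow> 'a \<Rightarrow> 'a \<Rightarrow> 'a \<Rightarrow> 'a" where
  "riemann br g x y z = (let D = levi_civita br g in
     D x (D y z) - D y (D x z) - D (br x y) z)"

definition ricci ::
  "('a::real_vector \<Rightarrow> 'a \<Rightarrow> 'a) \<Rightarrow> ('a \<Rightarrow> 'a \<Rightarrow> real) \<Rightarrow> 'a \<Rightarrow> 'a \<Rightarrow> real" where
  "ricci br g y z = lin_trace (\<lambda>x. riemann br g x y z)"

text \<open>\<open>ricci_flow_on br g0 g T\<close>: the curve of left-invariant metrics \<open>g\<close> solves the Ricci flow on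
  \<open>[0,T)\<close> with \<open>g 0 = g0\<close>. At \<open>t = 0\<close> the derivative is one-sided, and the values of \<open>g\<close>
  outside of \<open>[0,T)\<close> are irrelevant.\<close>

definition ricci_flow_on ::
  "('a::real_vector \<Rightarrow> 'a \<Rightarrow> 'a) \<Rightarrow> ('a \<Rightarrow> 'a \<Rightarrow> real) \<Rightarrow> (real \<Rightarrow> 'a \<Rightarrow> 'a \<Rightarrow> real) \<Rightarrow> ereal \<Rightarrow> bool" where
  "ricci_flow_on br g0 g T \<longleftrightarrow> 0 < T \<and> g 0 = g0 \<and>
     (\<forall>t. 0 \<le> t \<and> ereal t < T \<longrightarrow> inner_product (g t) \<and>
       (\<forall>x y. ((\<lambda>s. g s x y) has_real_derivative (- 2 * ricci br (g t) x y))
                (at t within {s. 0 \<le> s \<and> ereal s < T})))"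

definition maximal_ricci_flow ::
  "('a::real_vector \<Rightarrow> 'a \<Rightarrow> 'a) \<Rightarrow> ('a \<Rightarrow> 'a \<Rightarrow> real) \<Rightarrow> (real \<Rightarrow> 'a \<Rightarrow> 'a \<Rightarrow> real) \<Rightarrow> ereal \<Rightarrow> bool" where
  "maximal_ricci_flow br g0 g T \<longleftrightarrow> ricci_flow_on br g0 g T \<and>
     \<not> (\<exists>h T'. T < T' \<and> ricci_flow_on br g0 h T' \<and> (\<forall>t. 0 \<le> t \<and> ereal t < T \<longrightarrow> h t = g t))"

definition remains_diagonal ::
  "(real \<Rightarrow> 'a \<Rightarrow> 'a \<Rightarrow> real) \<Rightarrow> ereal \<Rightarrow> (nat \<Rightarrow> 'a) \<Rightarrow> nat set \<Rightarrow> bool" where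
  "remains_diagonal g T Y I \<longleftrightarrow>
     (\<forall>t. 0 \<le> t \<and> ereal t < T \<longrightarrow> (\<forall>i\<in>I. \<forall>j\<in>I. i \<noteq> j \<longrightarrow> g t (Y i) (Y j) = 0))"

lemma sum_representation_is_basis:
  assumes "is_basis C" shows "(\<Sum>c\<in>C. representation C v c *\<^sub>R c) = v"
  using assms by (intro real_vector.sum_representation_eq) (auto simp: is_basis_def)

lemma trace_basis_indep:
  fixes f :: "'a::real_vector \<Rightarrow> 'a"
  assumes f: "linear f" and B: "is_basis B" and C: "is_basis C"
  shows "(\<Sum>b\<in>B. representation B (f b) b) = (\<Sum>c\<in>C. representation C (f c) c)"
proof -
  have iB: "independent B" "\<And>v. v \<in> span B" and iC: "independent C" "\<And>v. v \<in> span C"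
    using B C by (auto simp: is_basis_def)
  have rep: "representation A (\<Sum>i\<in>I. r i *\<^sub>R v i) a = (\<Sum>i\<in>I. r i * representation A (v i) a)"
    if "independent A" "\<And>w. w \<in> span A"
    for A :: "'a set" and I :: "'a set" and r v a
    using that by (simp add: real_vector.representation_sum real_vector.representation_scale)
  have "representation B (f b) b = (\<Sum>c\<in>C. representation C b c * representation B (f c) b)" for b
  proof -
    have "f b = f (\<Sum>c\<in>C. representation C b c *\<^sub>R c)"
      by (simp add: sum_representation_is_basis C)
    also have "\<dots> = (\<Sum>c\<in>C. representation C b c *\<^sub>R f c)"
      by (simp add: linear_sum[OF f] linear_scale[OF f])
    finally show ?thesis
      by (simp add: rep[OF iB])
  qed
  then have "(\<Sum>b\<in>B. representation B (f b) b) =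
      (\<Sum>c\<in>C. \<Sum>b\<in>B. representation B (f c) b * representation C b c)"
    by (simp add: sum.swap[of _ C B] mult.commute)
  also have "\<dots> = (\<Sum>c\<in>C. representation C (\<Sum>b\<in>B. representation B (f c) b *\<^sub>R b) c)"
    by (simp add: rep[OF iC])
  finally show ?thesis
    by (simp add: sum_representation_is_basis B)
qed

lemma lin_trace_eq:
  assumes "linear f" "is_basis B"
  shows "lin_trace f = (\<Sum>b\<in>B. representation B (f b) b)"
  unfolding lin_trace_def Let_def
  by (rule trace_basis_indep) (use assms someI[of is_basis B] in auto)

lemma inner_product_eqI:
  assumes "inner_product g" "\<And>z. g x z = g y z" shows "x = y"
proof -
  have "g (x - y) (x - y) = 0"
    using assms(1) assms(2)[of "x - y"] by (auto simp: inner_product_def bilinear_lsub)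
  then show ?thesis
    using assms(1) unfolding inner_product_def by (metis less_irrefl right_minus_eq)
qed

lemma inner_product_riesz_span:
  fixes g :: "'a::real_vector \<Rightarrow> 'a \<Rightarrow> real"
  assumes g: "inner_product g" and "finite S" "linear p"
  shows "\<exists>w\<in>span S. \<forall>z\<in>span S. g w z = p z"
  using \<open>finite S\<close> \<open>linear p\<close>
proof (induction S arbitrary: p rule: finite_induct)
  case empty
  then show ?case using g by (auto simp: inner_product_def bilinear_rzero linear_0)
next
  case (insert b R)
  have bil: "bilinear g" and sym: "\<And>x y. g x y = g y x" using g by (auto simp: inner_product_def)
  note bil_simps = bilinear_ladd[OF bil] bilinear_radd[OF bil] bilinear_lsub[OF bil]
    bilinear_rsub[OF bil] bilinear_lmul[OF bil] bilinear_rmul[OF bil]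
  have "linear (g b)" using bil by (simp add: bilinear_def)
  then obtain u where u: "u \<in> span R" "\<And>z. z \<in> span R \<Longrightarrow> g u z = g b z"
    using insert.IH by blast
  obtain w where w: "w \<in> span R" "\<And>z. z \<in> span R \<Longrightarrow> g w z = p z"
    using insert.IH[OF insert.prems] by blast
  define e where "e = b - u"
  have orth: "g e z = 0" "g z e = 0" if "z \<in> span R" for z
    using u(2)[OF that] sym[of z] by (simp_all add: e_def bil_simps)
  define v where "v = w + ((p e / g e e) *\<^sub>R e)"
  have R: "span R \<subseteq> span (insert b R)" by (rule span_mono) auto
  have "e \<in> span (insert b R)"
    unfolding e_def using u(1) R by (auto intro: span_diff span_base)
  then have "v \<in> span (insert b R)"
    unfolding v_def using w(1) R by (auto intro: span_add span_scale)
  moreover have "g v z = p z" if zR: "z \<in> span (insert b R)" for z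
  proof -
    obtain k where k: "z - k *\<^sub>R b \<in> span R" using zR unfolding span_insert by blast
    define y where "y = (z - k *\<^sub>R b) + k *\<^sub>R u"
    have y: "y \<in> span R" unfolding y_def using k u(1) by (auto intro: span_add span_scale)
    have z: "z = y + k *\<^sub>R e" by (simp add: y_def e_def algebra_simps)
    have "g v e = p e"
    proof (cases "e = 0")
      case True
      then show ?thesis using insert.prems by (simp add: bilinear_rzero[OF bil] linear_0)
    next
      case False
      then have "g e e \<noteq> 0" using g by (force simp: inner_product_def)
      then show ?thesis by (simp add: v_def bil_simps orth w(1))
    qed
    moreover have "g v y = p y" using y w(2) by (simp add: v_def bil_simps orth)
    ultimately show ?thesis
      using insert.prems by (simp add: z bil_simps linear_add linear_scale)
  qed
  ultimately show ?case by blast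
qed

lemma ex1_levi_civita:
  fixes br :: "'a::real_vector \<Rightarrow> 'a \<Rightarrow> 'a" and B :: "'a set"
  assumes br: "lie_bracket br" and g: "inner_product g" and B: "is_basis B"
  shows "\<exists>!D. is_levi_civita br g D"
proof -
  have bil: "bilinear g" and sym: "\<And>x y. g x y = g y x" using g by (auto simp: inner_product_def)
  have bbil: "bilinear br" and alt: "\<And>x. br x x = 0" using br by (auto simp: lie_bracket_def)
  note bil_simps = bilinear_ladd[OF bil] bilinear_radd[OF bil] bilinear_lsub[OF bil]
    bilinear_rsub[OF bil] bilinear_lmul[OF bil] bilinear_rmul[OF bil] bilinear_lneg[OF bil]
    bilinear_ladd[OF bbil] bilinear_radd[OF bbil] bilinear_lmul[OF bbil] bilinear_rmul[OF bbil]
  have anti: "br x y = - br y x" for x y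
    using alt[of "x + y", unfolded bil_simps] by (simp add: alt eq_neg_iff_add_eq_0 add.commute)
  define K where "K x y z = (g (br x y) z - g (br y z) x + g (br z x) y) / 2" for x y z
  have linK: "linear (K x y)" for x y
    by (rule linearI) (simp_all add: K_def bil_simps algebra_simps add_divide_distrib diff_divide_distrib)
  have "\<exists>w. \<forall>z. g w z = K x y z" for x y
    using inner_product_riesz_span[OF g _ linK, of B x y] B by (auto simp: is_basis_def)
  then obtain D where D: "\<And>x y z. g (D x y) z = K x y z" by metis
  have "is_levi_civita br g D"
    unfolding is_levi_civita_def
  proof (intro conjI allI)
    show "bilinear D"
      unfolding bilinear_def
      by (intro conjI allI linearI inner_product_eqI[OF g])
        (simp_all add: bil_simps D, simp_all add: K_def bil_simps field_simps)
    fix x y z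
    show "D x y - D y x = br x y"
    proof (rule inner_product_eqI[OF g])
      fix z
      show "g (D x y - D y x) z = g (br x y) z"
        by (simp add: bil_simps D)
          (simp add: K_def bil_simps anti[of y x] anti[of z x] anti[of z y] field_simps)
    qed
    show "g (D x y) z + g y (D x z) = 0"
      unfolding sym[of y] D
      by (simp add: K_def bil_simps anti[of y x] anti[of z x] anti[of z y] field_simps)
  qed
  moreover have "E = D" if E: "is_levi_civita br g E" for E
  proof (intro ext inner_product_eqI[OF g])
    fix x y z
    have tor: "g (br a b) c = g (E a b) c - g (E b a) c" for a b c
      using E by (simp add: is_levi_civita_def flip: bil_simps(3))
    have met: "g (E a b) c = - g (E a c) b" for a b c
      using E sym[of b] unfolding is_levi_civita_def by (metis add_eq_0_iff2)
    show "g (E x y) z = g (D x y) z"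
      unfolding D K_def tor using met[of x y z] met[of y x z] met[of z x y] by simp
  qed
  ultimately show ?thesis by blast
qed

end

theory Submission
  imports Defs
begin

text \<open>Given the metric, choose an orthogonal basis \<open>f\<close> that is triangular with respect to the
  given one. Then \<open>[f1, f4] = - f1/2 + f2 + w f3\<close>, \<open>[f2, f4] = - f2/2 + v f3\<close>,
  \<open>[f3, f4] = f3\<close>, and the off-diagonal Ricci curvatures \<open>Ric(f1, f3)\<close> and \<open>Ric(f2, f3)\<close> both
  vanish only if \<open>v = w = 0\<close>. For \<open>f = Y\<close> one has \<open>v = 3/2 a1\<close> and \<open>w = 3/2 a3 - a1\<close>, and a flow
  that remains diagonal has diagonal Ricci tensor at time \<open>0\<close>.

  If \<open>a1 = a3 = 0\<close>, then \<open>Y\<close> satisfies the same bracket relations as \<open>X\<close>. Along the flow the pair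
  \<open>(g(Y1, Y3), g(Y2, Y3))\<close> solves a homogeneous linear system with continuous coefficients, hence
  stays zero. Thereafter \<open>g(Y1, Y2)\<close>, and then each \<open>g(Yi, Y4)\<close>, solves a homogeneous linear scalar
  equation, hence stays zero too. This replaces the uniqueness theorem for the flow.\<close>

section \<open>Orthogonal bases of an inner product\<close>

text \<open>Pairing a vanishing combination with \<open>b\<close> leaves only
  \<open>u b * g b b\<close>, and \<open>g b b > 0\<close>.\<close>

lemma orthogonal_imp_is_basis:
  fixes g :: "'a::real_vector \<Rightarrow> 'a \<Rightarrow> real"
  assumes g: "inner_product g" and B: "finite B" "span B = UNIV" "0 \<notin> B"
    and orth: "\<And>b c. b \<in> B \<Longrightarrow> c \<in> B \<Longrightarrow> b \<noteq> c \<Longrightarrow> g b c = 0"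
  shows "is_basis B"
proof -
  have bil: "bilinear g" and pos: "\<And>x. x \<noteq> 0 \<Longrightarrow> g x x > 0"
    using g by (auto simp: inner_product_def)
  have "independent B"
    unfolding dependent_finite[OF \<open>finite B\<close>]
  proof clarify
    fix u b assume b: "b \<in> B" "u b \<noteq> 0" and 0: "(\<Sum>v\<in>B. u v *\<^sub>R v) = 0"
    have lin: "linear (\<lambda>x. g x b)" using bil by (simp add: bilinear_def)
    have "g (\<Sum>v\<in>B. u v *\<^sub>R v) b = (\<Sum>v\<in>B. u v * g v b)"
      by (simp add: linear_sum[OF lin] linear_cmul[OF lin])
    also have "\<dots> = (\<Sum>v\<in>B. if v = b then u b * g b b else 0)"
      by (intro sum.cong) (auto simp: orth b)
    also have "\<dots> = u b * g b b" using b \<open>finite B\<close> by simp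
    finally have "u b * g b b = 0" using 0 by (simp add: bilinear_lzero[OF bil])
    moreover have "g b b > 0" using b \<open>0 \<notin> B\<close> by (intro pos) auto
    ultimately show False using b by simp
  qed
  then show ?thesis using B by (simp add: is_basis_def)
qed

lemma representation_orthogonal:
  fixes g :: "'a::real_vector \<Rightarrow> 'a \<Rightarrow> real"
  assumes g: "inner_product g" and B: "is_basis B"
    and orth: "\<And>b c. b \<in> B \<Longrightarrow> c \<in> B \<Longrightarrow> b \<noteq> c \<Longrightarrow> g b c = 0"
    and b: "b \<in> B"
  shows "representation B x b = g x b / g b b"
proof -
  have bil: "bilinear g" and pos: "\<And>x. x \<noteq> 0 \<Longrightarrow> g x x > 0"
    using g by (auto simp: inner_product_def)
  have fin: "finite B" and "0 \<notin> B" using B by (auto simp: is_basis_def dependent_zero)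
  have lin: "linear (\<lambda>x. g x b)" using bil by (simp add: bilinear_def)
  have "g (\<Sum>c\<in>B. representation B x c *\<^sub>R c) b = (\<Sum>c\<in>B. representation B x c * g c b)"
    by (simp add: linear_sum[OF lin] linear_cmul[OF lin])
  also have "\<dots> = (\<Sum>c\<in>B. if c = b then representation B x b * g b b else 0)"
    by (intro sum.cong) (auto simp: orth b)
  also have "\<dots> = representation B x b * g b b" using b fin by simp
  finally have "g x b = representation B x b * g b b"
    by (simp add: sum_representation_is_basis[OF B])
  moreover have "g b b > 0" using b \<open>0 \<notin> B\<close> by (intro pos) auto
  ultimately show ?thesis by (simp add: field_simps)
qed

lemma lie_bracket_anti:
  assumes "lie_bracket br"
  shows "br x y = - br y x"
proof -
  have bil: "bilinear br" and self: "\<And>x. br x x = 0" using assms by (auto simp: lie_bracket_def)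
  show ?thesis
    using self[of "x + y", unfolded bilinear_ladd[OF bil] bilinear_radd[OF bil]]
    by (simp add: self eq_neg_iff_add_eq_0 add.commute)
qed

section \<open>Levi-Civita connection and Ricci tensor in an orthogonal frame\<close>

text \<open>The constants \<open>v\<close> and \<open>w\<close> measure how far the frame is from
  satisfying the original bracket relations. That the frame is a basis follows from spanning,
  orthogonality and positive lengths.\<close>

locale solvable_frame =
  fixes br :: "'a::real_vector \<Rightarrow> 'a \<Rightarrow> 'a" and g :: "'a \<Rightarrow> 'a \<Rightarrow> real"
    and f1 f2 f3 f4 :: 'a and l1 l2 l3 l4 v w :: real
  assumes br: "lie_bracket br" and g: "inner_product g"
    and span: "span {f1, f2, f3, f4} = UNIV"
    and pos: "l1 > 0" "l2 > 0" "l3 > 0" "l4 > 0"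
    and diag: "g f1 f1 = l1" "g f2 f2 = l2" "g f3 f3 = l3" "g f4 f4 = l4"
    and orth: "g f1 f2 = 0" "g f1 f3 = 0" "g f1 f4 = 0" "g f2 f3 = 0" "g f2 f4 = 0" "g f3 f4 = 0"
    and abelian: "br f1 f2 = 0" "br f1 f3 = 0" "br f2 f3 = 0"
    and brackets: "br f1 f4 = - (1/2) *\<^sub>R f1 + f2 + w *\<^sub>R f3"
      "br f2 f4 = - (1/2) *\<^sub>R f2 + v *\<^sub>R f3" "br f3 f4 = f3"
begin

lemma g_bilinear: "bilinear g" and g_sym: "g x y = g y x"
  using g by (auto simp: inner_product_def)

lemma br_bilinear: "bilinear br" and br_self: "br x x = 0"
  using br by (auto simp: lie_bracket_def)

lemmas g_simps = bilinear_ladd[OF g_bilinear] bilinear_radd[OF g_bilinear]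
  bilinear_lsub[OF g_bilinear] bilinear_rsub[OF g_bilinear]
  bilinear_lmul[OF g_bilinear] bilinear_rmul[OF g_bilinear]
  bilinear_lneg[OF g_bilinear] bilinear_rneg[OF g_bilinear]
  bilinear_lzero[OF g_bilinear] bilinear_rzero[OF g_bilinear]

lemmas br_simps = bilinear_ladd[OF br_bilinear] bilinear_radd[OF br_bilinear]
  bilinear_lmul[OF br_bilinear] bilinear_rmul[OF br_bilinear]
  bilinear_lneg[OF br_bilinear] bilinear_rneg[OF br_bilinear]
  bilinear_lzero[OF br_bilinear] bilinear_rzero[OF br_bilinear]

lemmas br_anti = lie_bracket_anti[OF br]

text \<open>Products and brackets of frame vectors are collected in both orders, so that the
  simplifier can evaluate them without symmetry or antisymmetry as rewrite rules.\<close>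

lemmas frame = diag orth orth[THEN trans[OF g_sym]]

lemmas br_frame = br_self abelian brackets
  abelian[THEN trans[OF br_anti arg_cong[of _ _ uminus]]]
  brackets[THEN trans[OF br_anti arg_cong[of _ _ uminus]]]

lemma distinct: "f1 \<noteq> f2" "f1 \<noteq> f3" "f1 \<noteq> f4" "f2 \<noteq> f3" "f2 \<noteq> f4" "f3 \<noteq> f4"
  using diag orth pos by auto

lemma frame_orthogonal:
  "b \<in> {f1, f2, f3, f4} \<Longrightarrow> c \<in> {f1, f2, f3, f4} \<Longrightarrow> b \<noteq> c \<Longrightarrow> g b c = 0"
  by (auto simp: frame)

lemma frame_basis: "is_basis {f1, f2, f3, f4}"
proof (rule orthogonal_imp_is_basis[OF g _ span _ frame_orthogonal])
  show "0 \<notin> {f1, f2, f3, f4}" using diag pos by (auto simp: g_simps)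
qed auto

lemma frame_representation:
  "b \<in> {f1, f2, f3, f4} \<Longrightarrow> representation {f1, f2, f3, f4} x b = g x b / g b b"
  by (rule representation_orthogonal[OF g frame_basis]) (rule frame_orthogonal)

text \<open>Reduces the computation of a vector to its four products with the frame.\<close>

lemma expand:
  "x = (g x f1 / l1) *\<^sub>R f1 + (g x f2 / l2) *\<^sub>R f2 + (g x f3 / l3) *\<^sub>R f3 + (g x f4 / l4) *\<^sub>R f4"
proof -
  have "x = (\<Sum>b\<in>{f1, f2, f3, f4}. representation {f1, f2, f3, f4} x b *\<^sub>R b)"
    by (rule sum_representation_is_basis[OF frame_basis, symmetric])
  also have "\<dots> = (\<Sum>b\<in>{f1, f2, f3, f4}. (g x b / g b b) *\<^sub>R b)"
    by (intro sum.cong refl) (simp only: frame_representation)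
  finally show ?thesis by (simp add: distinct diag add.assoc)
qed

lemma lin_trace_frame:
  assumes "linear F"
  shows "lin_trace F = g (F f1) f1 / l1 + g (F f2) f2 / l2 + g (F f3) f3 / l3 + g (F f4) f4 / l4"
  by (simp add: lin_trace_eq[OF assms frame_basis] distinct diag frame_representation)

abbreviation "nabla \<equiv> levi_civita br g"

lemma nabla_levi_civita: "is_levi_civita br g nabla"
  unfolding levi_civita_def by (rule theI'[OF ex1_levi_civita[OF br g frame_basis]])

lemma nabla_bilinear: "bilinear nabla"
  using nabla_levi_civita by (simp add: is_levi_civita_def)

lemmas nabla_simps = bilinear_ladd[OF nabla_bilinear] bilinear_radd[OF nabla_bilinear]
  bilinear_lsub[OF nabla_bilinear] bilinear_rsub[OF nabla_bilinear]
  bilinear_lmul[OF nabla_bilinear] bilinear_rmul[OF nabla_bilinear]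
  bilinear_lneg[OF nabla_bilinear] bilinear_rneg[OF nabla_bilinear]
  bilinear_lzero[OF nabla_bilinear] bilinear_rzero[OF nabla_bilinear]

text \<open>The Koszul formula for left-invariant fields. Torsion-freeness turns the three brackets
  into six terms in \<open>nabla\<close>; by metric compatibility four of them cancel and the other
  two both equal the left-hand product.\<close>

lemma koszul: "g (nabla x y) z = (g (br x y) z - g (br y z) x + g (br z x) y) / 2"
proof -
  have tor: "g (br a b) c = g (nabla a b) c - g (nabla b a) c" for a b c
    using nabla_levi_civita by (simp add: is_levi_civita_def flip: g_simps(3))
  have met: "g (nabla a b) c = - g (nabla a c) b" for a b c
    using nabla_levi_civita g_sym[of b] unfolding is_levi_civita_def by (metis add_eq_0_iff2)
  show ?thesis
    unfolding tor using met[of x y z] met[of y x z] met[of z x y] by simp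
qed

lemma nabla_frame:
  "nabla f1 f1 = (l1 / (2 * l4)) *\<^sub>R f4"
  "nabla f1 f2 = - (l2 / (2 * l4)) *\<^sub>R f4"
  "nabla f1 f3 = - (w * l3 / (2 * l4)) *\<^sub>R f4"
  "nabla f1 f4 = - (1/2) *\<^sub>R f1 + (1/2) *\<^sub>R f2 + (w / 2) *\<^sub>R f3"
  "nabla f2 f1 = - (l2 / (2 * l4)) *\<^sub>R f4"
  "nabla f2 f2 = (l2 / (2 * l4)) *\<^sub>R f4"
  "nabla f2 f3 = - (v * l3 / (2 * l4)) *\<^sub>R f4"
  "nabla f2 f4 = (l2 / (2 * l1)) *\<^sub>R f1 - (1/2) *\<^sub>R f2 + (v / 2) *\<^sub>R f3"
  "nabla f3 f1 = - (w * l3 / (2 * l4)) *\<^sub>R f4"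
  "nabla f3 f2 = - (v * l3 / (2 * l4)) *\<^sub>R f4"
  "nabla f3 f3 = - (l3 / l4) *\<^sub>R f4"
  "nabla f3 f4 = (w * l3 / (2 * l1)) *\<^sub>R f1 + (v * l3 / (2 * l2)) *\<^sub>R f2 + f3"
  "nabla f4 f1 = - (1/2) *\<^sub>R f2 - (w / 2) *\<^sub>R f3"
  "nabla f4 f2 = (l2 / (2 * l1)) *\<^sub>R f1 - (v / 2) *\<^sub>R f3"
  "nabla f4 f3 = (w * l3 / (2 * l1)) *\<^sub>R f1 + (v * l3 / (2 * l2)) *\<^sub>R f2"
  "nabla f4 f4 = 0"
  \<comment> \<open>The coefficients in \<open>expand\<close> are evaluated by the Koszul
    formula.\<close>
  using pos by - (rule trans[OF expand], simp add: koszul br_frame g_simps frame)+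

lemma ricci_frame_sum:
  "ricci br g y z = g (riemann br g f1 y z) f1 / l1 + g (riemann br g f2 y z) f2 / l2
     + g (riemann br g f3 y z) f3 / l3 + g (riemann br g f4 y z) f4 / l4"
  unfolding ricci_def
  by (rule lin_trace_frame, rule linearI)
    (simp_all add: riemann_def Let_def nabla_simps br_simps algebra_simps)

text \<open>Serves to carry the frame values of \<open>ricci\<close> back to the basis in which the
  flow is written.\<close>

lemma ricci_bilinear: "bilinear (ricci br g)"
proof -
  have "riemann br g x (y + y') z = riemann br g x y z + riemann br g x y' z"
    "riemann br g x y (z + z') = riemann br g x y z + riemann br g x y z'"
    "riemann br g x (c *\<^sub>R y) z = c *\<^sub>R riemann br g x y z"
    "riemann br g x y (c *\<^sub>R z) = c *\<^sub>R riemann br g x y z" for x y y' z z' c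
    by (simp_all add: riemann_def Let_def nabla_simps br_simps scaleR_right_diff_distrib)
  then show ?thesis
    unfolding bilinear_def ricci_frame_sum
    by (intro conjI allI linearI) (simp_all add: g_simps add_divide_distrib distrib_left)
qed

text \<open>In the nonzero entries that involve \<open>f3\<close>, the products
  \<open>w * l3\<close> and \<open>v * l3\<close> are kept as units, since
  \<open>ricci_third\<close> replaces them by \<open>skew g\<close> and a multiple of
  \<open>g x2 x3\<close>.\<close>

lemma ricci_frame:
  "ricci br g f1 f1 = - (l2 + w\<^sup>2 * l3) / (2 * l4)"
  "ricci br g f1 f2 = - w * v * l3 / (2 * l4)"
  "ricci br g f1 f3 = - 3 * (w * l3) / (4 * l4)"
  "ricci br g f1 f4 = 0"
  "ricci br g f2 f1 = - w * v * l3 / (2 * l4)"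
  "ricci br g f2 f2 = (l2\<^sup>2 / l1 - v\<^sup>2 * l3) / (2 * l4)"
  "ricci br g f2 f3 = ((w * l3) * l2 / l1 - 3/2 * (v * l3)) / (2 * l4)"
  "ricci br g f2 f4 = 0"
  "ricci br g f3 f3 = ((w * l3)\<^sup>2 / l1 + (v * l3)\<^sup>2 / l2) / (2 * l4)"
  "ricci br g f3 f4 = 0"
  "ricci br g f3 f1 = - 3 * (w * l3) / (4 * l4)"
  "ricci br g f3 f2 = ((w * l3) * l2 / l1 - 3/2 * (v * l3)) / (2 * l4)"
  using pos unfolding ricci_frame_sum riemann_def Let_def
  by (simp_all add: nabla_frame nabla_simps br_frame br_simps g_simps frame)
   (simp_all add: divide_simps, simp_all add: algebra_simps power2_eq_square)

end

section \<open>Uniqueness of the zero solution of a linear planar system\<close>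

text \<open>A Gronwall argument: if \<open>C\<close> bounds the sum of the absolute values of the
  coefficients, then \<open>x^2 + y^2\<close> grows at most at rate \<open>2 * C\<close>. Hence its
  product with \<open>exp (- 2 * C * t)\<close> is nonincreasing, and it starts at zero.\<close>

lemma linear_ode_zero:
  fixes x y p q r s :: "real \<Rightarrow> real"
  assumes x: "\<And>t. t \<in> {0..\<tau>} \<Longrightarrow>
      (x has_real_derivative p t * x t + q t * y t) (at t within {0..\<tau>})"
    and y: "\<And>t. t \<in> {0..\<tau>} \<Longrightarrow>
      (y has_real_derivative r t * x t + s t * y t) (at t within {0..\<tau>})"
    and cont: "continuous_on {0..\<tau>} p" "continuous_on {0..\<tau>} q"
      "continuous_on {0..\<tau>} r" "continuous_on {0..\<tau>} s"
    and zero: "x 0 = 0" "y 0 = 0" and t: "t \<in> {0..\<tau>}"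
  shows "x t = 0 \<and> y t = 0"
proof -
  have "continuous_on {0..\<tau>} (\<lambda>t. \<bar>p t\<bar> + \<bar>q t\<bar> + \<bar>r t\<bar> + \<bar>s t\<bar>)"
    by (intro continuous_intros cont)
  then have "bounded ((\<lambda>t. \<bar>p t\<bar> + \<bar>q t\<bar> + \<bar>r t\<bar> + \<bar>s t\<bar>) ` {0..\<tau>})"
    by (intro compact_imp_bounded compact_continuous_image) auto
  then obtain C where C: "\<And>t. t \<in> {0..\<tau>} \<Longrightarrow> \<bar>p t\<bar> + \<bar>q t\<bar> + \<bar>r t\<bar> + \<bar>s t\<bar> \<le> C"
    unfolding bounded_iff by force
  define F where "F t = ((x t)\<^sup>2 + (y t)\<^sup>2) * exp (- 2 * C * t)" for t
  define F' where "F' t = (2 * x t * (p t * x t + q t * y t) + 2 * y t * (r t * x t + s t * y t)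
      - 2 * C * ((x t)\<^sup>2 + (y t)\<^sup>2)) * exp (- 2 * C * t)" for t
  have F: "(F has_real_derivative F' t) (at t within {0..\<tau>})" if "t \<in> {0..\<tau>}" for t
    unfolding F_def F'_def
    by (rule derivative_eq_intros x[OF that] y[OF that] refl | simp)+ (simp add: algebra_simps)
  have F'_nonpos: "F' t \<le> 0" if "t \<in> {0..\<tau>}" for t
  proof -
    define E where "E = (x t)\<^sup>2 + (y t)\<^sup>2"
    \<comment> \<open>The monomials \<open>x^2\<close>, \<open>x y\<close> and \<open>y^2\<close>
      are all at most \<open>E\<close> in absolute value, so each coefficient contributes at most
      its absolute value times \<open>E\<close>.\<close>
    have le: "k * z \<le> \<bar>k\<bar> * E" if "\<bar>z\<bar> \<le> E" for k z
      using mult_left_mono[OF that, of "\<bar>k\<bar>"] abs_mult[of k z] by linarith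
    have xy: "\<bar>x t * y t\<bar> \<le> E"
      using sum_squares_bound[of "\<bar>x t\<bar>" "\<bar>y t\<bar>"] abs_ge_zero[of "x t * y t"]
      unfolding E_def abs_mult power2_abs by linarith
    have "p t * (x t)\<^sup>2 + q t * (x t * y t) + r t * (x t * y t) + s t * (y t)\<^sup>2
        \<le> \<bar>p t\<bar> * E + \<bar>q t\<bar> * E + \<bar>r t\<bar> * E + \<bar>s t\<bar> * E"
      by (intro add_mono le xy) (auto simp: E_def)
    also have "\<dots> = (\<bar>p t\<bar> + \<bar>q t\<bar> + \<bar>r t\<bar> + \<bar>s t\<bar>) * E" by (simp add: algebra_simps)
    also have "\<dots> \<le> C * E" by (rule mult_right_mono[OF C[OF that]]) (simp add: E_def)
    finally have "2 * x t * (p t * x t + q t * y t) + 2 * y t * (r t * x t + s t * y t)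
        - 2 * C * ((x t)\<^sup>2 + (y t)\<^sup>2) \<le> 0"
      unfolding E_def by (simp add: algebra_simps power2_eq_square)
    then show ?thesis unfolding F'_def by (rule mult_nonpos_nonneg) simp
  qed
  have "F t \<le> F 0"
  proof (rule DERIV_nonpos_imp_decreasing_open[where f = F and a = 0 and b = t])
    show "0 \<le> t" using t by simp
    show "\<exists>d. DERIV F z :> d \<and> d \<le> 0" if "0 < z" "z < t" for z
      using F[of z] F'_nonpos[of z] that t at_within_Icc_at[of 0 z \<tau>] by force
    show "continuous_on {0..t} F"
      by (rule continuous_on_subset[OF DERIV_continuous_on[OF F]]) (use t in auto)
  qed
  then have "(x t)\<^sup>2 + (y t)\<^sup>2 \<le> 0"
    by (simp add: F_def zero mult_le_0_iff not_le)
  then show ?thesis by (simp add: sum_power2_le_zero_iff)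
qed


section \<open>The Lie algebra and its triangular changes of basis\<close>

text \<open>Stated for arbitrary vectors so that it can be interpreted both for \<open>X\<close> and
  for \<open>Y\<close>. Independence in terms of coefficients also makes the four vectors
  distinct.\<close>

locale solvable_lie_algebra =
  fixes br :: "'a::real_vector \<Rightarrow> 'a \<Rightarrow> 'a" and x1 x2 x3 x4 :: 'a
  assumes br: "lie_bracket br"
    and span: "span {x1, x2, x3, x4} = UNIV"
    and indep: "\<And>c1 c2 c3 c4. c1 *\<^sub>R x1 + c2 *\<^sub>R x2 + c3 *\<^sub>R x3 + c4 *\<^sub>R x4 = 0 \<Longrightarrow>
      c1 = 0 \<and> c2 = 0 \<and> c3 = 0 \<and> c4 = 0"
    and abelian: "br x1 x2 = 0" "br x1 x3 = 0" "br x2 x3 = 0"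
    and brackets: "br x1 x4 = - (1/2) *\<^sub>R x1 + x2" "br x2 x4 = - (1/2) *\<^sub>R x2" "br x3 x4 = x3"
begin

lemma br_bilinear: "bilinear br" and br_self: "br x x = 0"
  using br by (auto simp: lie_bracket_def)

lemmas br_simps = bilinear_ladd[OF br_bilinear] bilinear_radd[OF br_bilinear]
  bilinear_lmul[OF br_bilinear] bilinear_rmul[OF br_bilinear]

lemmas br_anti = lie_bracket_anti[OF br]

context
  fixes a1 a2 a3 a4 a5 a6 :: real and y1 y2 y3 y4 :: 'a
  assumes y: "y1 = x1 + a2 *\<^sub>R x2 + a3 *\<^sub>R x3" "y2 = x2 + a1 *\<^sub>R x3" "y3 = x3"
    "y4 = a4 *\<^sub>R x1 + a5 *\<^sub>R x2 + a6 *\<^sub>R x3 + x4"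
begin

lemma inverse_change:
  "x1 = y1 - a2 *\<^sub>R y2 + (a1 * a2 - a3) *\<^sub>R y3" "x2 = y2 - a1 *\<^sub>R y3" "x3 = y3"
  "x4 = y4 - a4 *\<^sub>R x1 - a5 *\<^sub>R x2 - a6 *\<^sub>R x3"
  unfolding y by (simp_all add: algebra_simps)

lemma span_change: "span {y1, y2, y3, y4} = UNIV"
proof -
  let ?S = "span {y1, y2, y3, y4}"
  have y_in: "y1 \<in> ?S" "y2 \<in> ?S" "y3 \<in> ?S" "y4 \<in> ?S" by (auto intro: span_base)
  have 3: "x3 \<in> ?S" and 2: "x2 \<in> ?S" and 1: "x1 \<in> ?S"
    unfolding inverse_change by (intro span_add span_diff span_scale y_in)+
  have 4: "x4 \<in> ?S"
    unfolding inverse_change(4) by (intro span_diff span_scale y_in 1 2 3)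
  have "span {x1, x2, x3, x4} \<subseteq> ?S"
    by (rule span_minimal) (use 1 2 3 4 in auto)
  then show ?thesis using span by auto
qed

lemma indep_change:
  assumes "c1 *\<^sub>R y1 + c2 *\<^sub>R y2 + c3 *\<^sub>R y3 + c4 *\<^sub>R y4 = 0"
  shows "c1 = 0 \<and> c2 = 0 \<and> c3 = 0 \<and> c4 = 0"
proof -
  have "(c1 + c4 * a4) *\<^sub>R x1 + (c1 * a2 + c2 + c4 * a5) *\<^sub>R x2
      + (c1 * a3 + c2 * a1 + c3 + c4 * a6) *\<^sub>R x3 + c4 *\<^sub>R x4 = 0"
    using assms unfolding y by (simp add: algebra_simps)
  from indep[OF this] show ?thesis by auto
qed

text \<open>Since \<open>x1\<close>, \<open>x2\<close>, \<open>x3\<close> span an abelian ideal,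
  \<open>a4\<close>, \<open>a5\<close>, \<open>a6\<close> drop out. Bracketing with
  \<open>x4\<close> acts on this ideal with a Jordan block of eigenvalue \<open>-1/2\<close> on
  \<open>x1\<close>, \<open>x2\<close> and eigenvalue \<open>1\<close> on \<open>x3\<close>. The
  shear \<open>a2\<close> commutes with the block and drops out; mixing in \<open>x3\<close> brings
  in the difference \<open>3/2\<close> of the eigenvalues.\<close>

lemma br_change:
  "br y1 y2 = 0" "br y1 y3 = 0" "br y2 y3 = 0"
  "br y1 y4 = - (1/2) *\<^sub>R y1 + y2 + (3/2 * a3 - a1) *\<^sub>R y3"
  "br y2 y4 = - (1/2) *\<^sub>R y2 + (3/2 * a1) *\<^sub>R y3"
  "br y3 y4 = y3"
proof -
  note ab = abelian abelian[THEN trans[OF br_anti arg_cong[of _ _ uminus]]] br_self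
  have add: "c *\<^sub>R x3 + (c / 2) *\<^sub>R x3 = (c * 3 / 2) *\<^sub>R x3" for c
    by (simp flip: scaleR_add_left)
  show "br y1 y2 = 0" "br y1 y3 = 0" "br y2 y3 = 0" "br y3 y4 = y3"
    unfolding y by (simp_all add: br_simps ab brackets)
  show "br y1 y4 = - (1/2) *\<^sub>R y1 + y2 + (3/2 * a3 - a1) *\<^sub>R y3"
    unfolding y by (simp add: br_simps ab brackets algebra_simps add)
  show "br y2 y4 = - (1/2) *\<^sub>R y2 + (3/2 * a1) *\<^sub>R y3"
    unfolding y by (simp add: br_simps ab brackets algebra_simps add)
qed

text \<open>Serves twice: for \<open>Y\<close> under the initial metric, and for the Gram-Schmidt
  frame of each metric along the flow.\<close>

lemma solvable_frame_change:
  assumes g: "inner_product g"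
    and orth: "g y1 y2 = 0" "g y1 y3 = 0" "g y1 y4 = 0" "g y2 y3 = 0" "g y2 y4 = 0" "g y3 y4 = 0"
  shows "solvable_frame br g y1 y2 y3 y4 (g y1 y1) (g y2 y2) (g y3 y3) (g y4 y4)
    (3/2 * a1) (3/2 * a3 - a1)"
proof -
  have "y1 \<noteq> 0" using indep_change[of 1 0 0 0] by auto
  moreover have "y2 \<noteq> 0" using indep_change[of 0 1 0 0] by auto
  moreover have "y3 \<noteq> 0" using indep_change[of 0 0 1 0] by auto
  moreover have "y4 \<noteq> 0" using indep_change[of 0 0 0 1] by auto
  ultimately show ?thesis
    using g by unfold_locales (auto simp: br g span_change orth br_change inner_product_def)
qed

text \<open>Reduces the sufficiency of \<open>a1 = a3 = 0\<close> to metrics that are diagonal in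
  the original basis.\<close>

lemma solvable_lie_algebra_change:
  assumes "a1 = 0" "a3 = 0"
  shows "solvable_lie_algebra br y1 y2 y3 y4"
  by unfold_locales (use br span_change indep_change br_change assms in auto)

end

text \<open>Gram-Schmidt orthogonalisation in the order \<open>x3\<close>, \<open>x2\<close>, \<open>x1\<close>, \<open>x4\<close>: every inner product
  is diagonal in a basis of the form considered in \<open>solvable_frame_change\<close>.\<close>

definition "gs1 g = - g x2 x3 / g x3 x3" for g :: "'a \<Rightarrow> 'a \<Rightarrow> real"
definition "len2 g = g x2 x2 + gs1 g * g x2 x3"
definition "gs2 g = - (g x1 x2 + gs1 g * g x1 x3) / len2 g"
definition "gs3 g = - (g x1 x3 + gs2 g * g x2 x3) / g x3 x3"
definition "len1 g = g x1 x1 + gs2 g * g x1 x2 + gs3 g * g x1 x3"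
definition "gs4 g = - (g x1 x4 + gs2 g * g x2 x4 + gs3 g * g x3 x4) / len1 g"
definition "gs5 g = - (g x2 x4 + gs1 g * g x3 x4 + gs4 g * (g x1 x2 + gs1 g * g x1 x3)) / len2 g"
definition "gs6 g = - (g x3 x4 + gs4 g * g x1 x3 + gs5 g * g x2 x3) / g x3 x3"
definition "len4 g = g x4 x4 + gs4 g * g x1 x4 + gs5 g * g x2 x4 + gs6 g * g x3 x4"
definition "frame1 g = x1 + gs2 g *\<^sub>R x2 + gs3 g *\<^sub>R x3"
definition "frame2 g = x2 + gs1 g *\<^sub>R x3"
definition "frame4 g = gs4 g *\<^sub>R x1 + gs5 g *\<^sub>R x2 + gs6 g *\<^sub>R x3 + x4"

text \<open>\<open>skew g\<close> is \<open>w l3\<close> for the Gram-Schmidt frame, rewritten to be linear in \<open>g x1 x3\<close> and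
  \<open>g x2 x3\<close>, and likewise \<open>v l3 = - 3/2 * g x2 x3\<close>.\<close>

definition "skew g = - 3/2 * g x1 x3 + (1 - 3/2 * gs2 g) * g x2 x3"
definition "ricci33 g = ((skew g)\<^sup>2 / len1 g + (3/2 * g x2 x3)\<^sup>2 / len2 g) / (2 * len4 g)"

section \<open>Ricci tensor of an arbitrary inner product in the given basis\<close>

context
  fixes g :: "'a \<Rightarrow> 'a \<Rightarrow> real"
  assumes g: "inner_product g"
begin

lemma g_bilinear: "bilinear g" and g_sym: "g x y = g y x" and g_pos: "x \<noteq> 0 \<Longrightarrow> g x x > 0"
  using g by (auto simp: inner_product_def)

lemmas g_simps = bilinear_ladd[OF g_bilinear] bilinear_radd[OF g_bilinear]
  bilinear_lsub[OF g_bilinear] bilinear_rsub[OF g_bilinear]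
  bilinear_lmul[OF g_bilinear] bilinear_rmul[OF g_bilinear]

lemmas g_swap = g_sym[of x2 x1] g_sym[of x3 x1] g_sym[of x4 x1] g_sym[of x3 x2] g_sym[of x4 x2]
  g_sym[of x4 x3]

lemma len3_pos: "g x3 x3 > 0"
  using indep[of 0 0 1 0] by (intro g_pos) auto

lemma gs_orth_23: "g (frame2 g) x3 = 0"
  using len3_pos by (simp add: frame2_def gs1_def g_simps)

text \<open>The definitions of the lengths use products of basis vectors, from which continuity
  along the flow can be read off; orthogonality identifies them with squared lengths of frame
  vectors.\<close>

lemma frame2_len: "g (frame2 g) (frame2 g) = len2 g"
  using gs_orth_23 by (simp add: frame2_def len2_def g_simps g_swap)

lemma len2_pos: "len2 g > 0"
  unfolding frame2_len[symmetric] using indep[of 0 1 "gs1 g" 0]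
  by (intro g_pos) (auto simp: frame2_def)

lemma gs_orth_13: "g (frame1 g) x3 = 0"
  using len3_pos by (simp add: frame1_def gs3_def g_simps field_simps)

text \<open>As \<open>frame2 g\<close> is orthogonal to \<open>x3\<close>, the coefficient
  \<open>gs3 g\<close> does not enter, and \<open>gs2 g\<close> solves a single linear
  equation.\<close>

lemma gs_orth_12: "g (frame1 g) (frame2 g) = 0"
proof -
  have "g (frame1 g) (frame2 g) = g x1 (frame2 g) + gs2 g * g x2 (frame2 g) + gs3 g * g x3 (frame2 g)"
    by (simp add: frame1_def g_simps)
  also have "g x1 (frame2 g) = g x1 x2 + gs1 g * g x1 x3"
    by (simp add: frame2_def g_simps)
  also have "g x2 (frame2 g) = len2 g"
    by (simp add: frame2_def len2_def g_simps)
  also have "g x3 (frame2 g) = 0"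
    using gs_orth_23 g_sym by simp
  finally show ?thesis using len2_pos by (simp add: gs2_def)
qed

lemma gs_orth_1: "g (frame1 g) x2 = 0"
  using gs_orth_12 gs_orth_13 by (simp add: frame2_def g_simps)

lemma frame1_len: "g (frame1 g) (frame1 g) = len1 g"
proof -
  have "g (frame1 g) (frame1 g) = g (frame1 g) x1 + gs2 g * g (frame1 g) x2 + gs3 g * g (frame1 g) x3"
    by (subst (2) frame1_def) (simp add: g_simps)
  also have "g (frame1 g) x1 = len1 g"
    by (simp add: frame1_def len1_def g_simps g_swap)
  finally show ?thesis by (simp add: gs_orth_1 gs_orth_13)
qed

lemma len1_pos: "len1 g > 0"
  unfolding frame1_len[symmetric] using indep[of 1 "gs2 g" "gs3 g" 0]
  by (intro g_pos) (auto simp: frame1_def)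

text \<open>The equations for \<open>frame4 g\<close> are triangular: orthogonality to
  \<open>frame1 g\<close> determines \<open>gs4 g\<close>, then \<open>frame2 g\<close> determines
  \<open>gs5 g\<close>, and finally \<open>x3\<close> determines \<open>gs6 g\<close>.\<close>

lemma gs_orth_14: "g (frame1 g) (frame4 g) = 0"
proof -
  have "g (frame1 g) x1 = len1 g"
    by (simp add: frame1_def len1_def g_simps g_swap)
  moreover have "g (frame1 g) x4 = g x1 x4 + gs2 g * g x2 x4 + gs3 g * g x3 x4"
    by (simp add: frame1_def g_simps)
  ultimately have "g (frame1 g) (frame4 g)
      = gs4 g * len1 g + (g x1 x4 + gs2 g * g x2 x4 + gs3 g * g x3 x4)"
    by (simp add: frame4_def g_simps gs_orth_1 gs_orth_13)
  then show ?thesis using len1_pos by (simp add: gs4_def)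
qed

lemma gs_orth_24: "g (frame2 g) (frame4 g) = 0"
proof -
  have "g (frame2 g) x1 = g x1 x2 + gs1 g * g x1 x3"
    by (simp add: frame2_def g_simps g_swap)
  moreover have "g (frame2 g) x2 = len2 g"
    by (simp add: frame2_def len2_def g_simps g_swap)
  moreover have "g (frame2 g) x4 = g x2 x4 + gs1 g * g x3 x4"
    by (simp add: frame2_def g_simps)
  ultimately have "g (frame2 g) (frame4 g) = gs4 g * (g x1 x2 + gs1 g * g x1 x3)
      + gs5 g * len2 g + (g x2 x4 + gs1 g * g x3 x4)"
    by (simp add: frame4_def g_simps gs_orth_23)
  then show ?thesis using len2_pos by (simp add: gs5_def)
qed

lemma gs_orth_34: "g x3 (frame4 g) = 0"
  using len3_pos by (simp add: frame4_def gs6_def g_simps g_swap)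

lemma frame4_len: "g (frame4 g) (frame4 g) = len4 g"
proof -
  have 3: "g (frame4 g) x3 = 0" using gs_orth_34 g_sym by simp
  have 2: "g (frame4 g) x2 = 0" using gs_orth_24 g_sym[of "frame2 g"] 3 by (simp add: frame2_def g_simps)
  have 1: "g (frame4 g) x1 = 0"
    using gs_orth_14 g_sym[of "frame1 g"] 2 3 by (simp add: frame1_def g_simps)
  have "g (frame4 g) (frame4 g) = g (frame4 g) x4"
    by (subst (2) frame4_def) (simp add: g_simps 1 2 3)
  then show ?thesis by (simp add: frame4_def len4_def g_simps g_swap)
qed

lemma len4_pos: "len4 g > 0"
  unfolding frame4_len[symmetric] using indep[of "gs4 g" "gs5 g" "gs6 g" 1]
  by (intro g_pos) (auto simp: frame4_def)

lemma gs_frame: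
  "solvable_frame br g (frame1 g) (frame2 g) x3 (frame4 g) (len1 g) (len2 g) (g x3 x3) (len4 g)
    (3/2 * gs1 g) (3/2 * gs3 g - gs1 g)"
  using solvable_frame_change[OF frame1_def frame2_def refl frame4_def g
      gs_orth_12 gs_orth_13 gs_orth_14 gs_orth_23 gs_orth_24 gs_orth_34]
  by (simp add: frame1_len frame2_len frame4_len)

lemmas gs_inverse = inverse_change[OF frame1_def[of g] frame2_def[of g] refl frame4_def[of g]]

lemmas ricci_simps =
  bilinear_ladd[OF solvable_frame.ricci_bilinear[OF gs_frame]]
  bilinear_radd[OF solvable_frame.ricci_bilinear[OF gs_frame]]
  bilinear_lsub[OF solvable_frame.ricci_bilinear[OF gs_frame]]
  bilinear_rsub[OF solvable_frame.ricci_bilinear[OF gs_frame]]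
  bilinear_lmul[OF solvable_frame.ricci_bilinear[OF gs_frame]]
  bilinear_rmul[OF solvable_frame.ricci_bilinear[OF gs_frame]]

lemmas ricci_gs = solvable_frame.ricci_frame[OF gs_frame]

text \<open>Every summand contains \<open>skew g\<close>, \<open>g x1 x3\<close> or
  \<open>g x2 x3\<close> as a factor. With the remaining factors taken as coefficients, both values
  are homogeneous linear in these two products.\<close>

lemma ricci_third:
  "ricci br g x1 x3 = - 3 * skew g / (4 * len4 g)
     - gs2 g * ((skew g * len2 g / len1 g + 9/4 * g x2 x3) / (2 * len4 g))
     + g x1 x3 / g x3 x3 * ricci33 g"
  "ricci br g x2 x3 = (skew g * len2 g / len1 g + 9/4 * g x2 x3) / (2 * len4 g)
     + g x2 x3 / g x3 x3 * ricci33 g"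
proof -
  have 1: "gs1 g * g x3 x3 = - g x2 x3" and 3: "gs3 g * g x3 x3 = - (g x1 x3 + gs2 g * g x2 x3)"
    using len3_pos by (simp_all add: gs1_def gs3_def)
  have w: "(3/2 * gs3 g - gs1 g) * g x3 x3 = skew g" and v: "3/2 * gs1 g * g x3 x3 = - 3/2 * g x2 x3"
    using 1 3 by (simp_all add: skew_def left_diff_distrib mult.assoc)
  \<comment> \<open>The left side is the coefficient of \<open>x3\<close> in the expansion of
    \<open>x1\<close> along the frame, hence an orthogonal projection coefficient.\<close>
  have 13: "gs1 g * gs2 g - gs3 g = g x1 x3 / g x3 x3"
  proof -
    have "(gs1 g * gs2 g - gs3 g) * g x3 x3 = gs2 g * (gs1 g * g x3 x3) - gs3 g * g x3 x3"
      by (simp add: algebra_simps)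
    also have "\<dots> = g x1 x3" unfolding 1 3 by simp
    finally show ?thesis using len3_pos by (simp add: field_simps)
  qed
  have gs1: "gs1 g = - (g x2 x3 / g x3 x3)" by (simp add: gs1_def)
  note R = ricci_gs[unfolded w v]
  have R33: "ricci br g x3 x3 = ricci33 g"
    unfolding R ricci33_def by (simp add: power_mult_distrib)
  have R23: "ricci br g (frame2 g) x3 = (skew g * len2 g / len1 g + 9/4 * g x2 x3) / (2 * len4 g)"
    unfolding R by simp
  show "ricci br g x2 x3 = (skew g * len2 g / len1 g + 9/4 * g x2 x3) / (2 * len4 g)
     + g x2 x3 / g x3 x3 * ricci33 g"
    unfolding arg_cong[OF gs_inverse(2), of "\<lambda>x. ricci br g x x3"] ricci_simps R23 R33 gs1
    by simp
  show "ricci br g x1 x3 = - 3 * skew g / (4 * len4 g)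
     - gs2 g * ((skew g * len2 g / len1 g + 9/4 * g x2 x3) / (2 * len4 g))
     + g x1 x3 / g x3 x3 * ricci33 g"
    unfolding arg_cong[OF gs_inverse(1), of "\<lambda>x. ricci br g x x3"] ricci_simps R23 R33 R(3) 13
    by simp
qed

text \<open>Here \<open>v = w = 0\<close>, so the entry of \<open>ricci\<close> at
  \<open>frame1 g\<close>, \<open>frame2 g\<close> vanishes. What remains is \<open>- gs2 g\<close>
  times the entry at \<open>frame2 g\<close>, and \<open>gs2 g\<close> is a multiple of
  \<open>g x1 x2\<close>.\<close>

lemma ricci_12:
  assumes "g x1 x3 = 0" "g x2 x3 = 0"
  shows "ricci br g x1 x2 = g x1 x2 * (len2 g / (2 * len1 g * len4 g))"
proof -
  have gs: "gs1 g = 0" "gs3 g = 0" and gs2: "gs2 g = - g x1 x2 / len2 g"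
    by (simp_all add: gs1_def gs2_def gs3_def assms)
  note R = ricci_gs[unfolded gs, simplified]
  have x2: "x2 = frame2 g" by (simp add: frame2_def gs)
  have x1: "x1 = frame1 g - gs2 g *\<^sub>R frame2 g"
    by (simp add: frame1_def frame2_def gs)
  have "ricci br g x1 x2 = - gs2 g * ricci br g (frame2 g) (frame2 g)"
    unfolding arg_cong2[OF x1 x2, of "ricci br g"] ricci_simps R by simp
  then show ?thesis
    using len1_pos len2_pos len4_pos by (simp add: R gs2 power2_eq_square)
qed

text \<open>Now \<open>x1\<close>, \<open>x2\<close>, \<open>x3\<close> belong to the frame and
  \<open>v = w = 0\<close>. Expanding \<open>x4\<close> leaves only the diagonal entries of
  \<open>ricci\<close>, weighted by \<open>gs4 g\<close>, \<open>gs5 g\<close>,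
  \<open>gs6 g\<close>; the entry at \<open>x3\<close> is zero.\<close>

lemma ricci_fourth:
  assumes "g x1 x2 = 0" "g x1 x3 = 0" "g x2 x3 = 0"
  shows "ricci br g x1 x4 = g x1 x4 * (- len2 g / (2 * len1 g * len4 g))"
    "ricci br g x2 x4 = g x2 x4 * (len2 g / (2 * len1 g * len4 g))"
    "ricci br g x3 x4 = 0"
proof -
  have gs: "gs1 g = 0" "gs2 g = 0" "gs3 g = 0"
    and gs4: "gs4 g = - g x1 x4 / len1 g" and gs5: "gs5 g = - g x2 x4 / len2 g"
    by (simp_all add: gs1_def gs2_def gs3_def gs4_def gs5_def assms)
  have x: "frame1 g = x1" "frame2 g = x2" by (simp_all add: frame1_def frame2_def gs)
  note R = ricci_gs[unfolded gs x, simplified]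
  show "ricci br g x1 x4 = g x1 x4 * (- len2 g / (2 * len1 g * len4 g))"
    "ricci br g x2 x4 = g x2 x4 * (len2 g / (2 * len1 g * len4 g))"
    "ricci br g x3 x4 = 0"
    using len1_pos len2_pos len4_pos
    by (simp_all add: arg_cong[OF gs_inverse(4), of "ricci br g _"] ricci_simps R gs4 gs5
        power2_eq_square)
qed

end

section \<open>Preservation of diagonality along the flow\<close>

lemma flow_remains_diagonal:
  assumes flow: "ricci_flow_on br g0 g T" and t: "0 \<le> t" "ereal t < T"
    and g0: "g0 x1 x2 = 0" "g0 x1 x3 = 0" "g0 x1 x4 = 0" "g0 x2 x3 = 0" "g0 x2 x4 = 0" "g0 x3 x4 = 0"
  shows "g t x1 x2 = 0" "g t x1 x3 = 0" "g t x1 x4 = 0" "g t x2 x3 = 0" "g t x2 x4 = 0" "g t x3 x4 = 0"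
proof -
  have in_T: "ereal s < T" if "s \<in> {0..t}" for s
    using that t(2) le_less_trans[of "ereal s" "ereal t" T] by auto
  have inner: "inner_product (g s)" if "s \<in> {0..t}" for s
    using flow that in_T[OF that] by (auto simp: ricci_flow_on_def)
  have der: "((\<lambda>s. g s x y) has_real_derivative - 2 * ricci br (g s) x y) (at s within {0..t})"
    if "s \<in> {0..t}" for s x y
  proof (rule DERIV_subset)
    show "((\<lambda>s. g s x y) has_real_derivative - 2 * ricci br (g s) x y)
        (at s within {s. 0 \<le> s \<and> ereal s < T})"
      using flow that in_T[OF that] by (auto simp: ricci_flow_on_def)
  qed (use in_T in auto)
  have cont: "continuous_on {0..t} (\<lambda>s. g s x y)" for x y
    by (rule DERIV_continuous_on[OF der])
  have init: "g 0 = g0" using flow by (simp add: ricci_flow_on_def)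
  have nz: "g s x3 x3 \<noteq> 0" "len1 (g s) \<noteq> 0" "len2 (g s) \<noteq> 0" "len4 (g s) \<noteq> 0" if "s \<in> {0..t}" for s
    using len3_pos[OF inner[OF that]] len1_pos[OF inner[OF that]] len2_pos[OF inner[OF that]]
      len4_pos[OF inner[OF that]] by simp_all
  \<comment> \<open>Continuity is derived in the order in which the Gram-Schmidt quantities depend
    on one another.\<close>
  have c1: "continuous_on {0..t} (\<lambda>s. gs1 (g s))"
    unfolding gs1_def by (intro continuous_intros cont) (use nz in auto)
  have l2: "continuous_on {0..t} (\<lambda>s. len2 (g s))"
    unfolding len2_def by (intro continuous_intros cont c1)
  have c2: "continuous_on {0..t} (\<lambda>s. gs2 (g s))"
    unfolding gs2_def by (intro continuous_intros cont c1 l2) (use nz in auto)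
  have c3: "continuous_on {0..t} (\<lambda>s. gs3 (g s))"
    unfolding gs3_def by (intro continuous_intros cont c2) (use nz in auto)
  have l1: "continuous_on {0..t} (\<lambda>s. len1 (g s))"
    unfolding len1_def by (intro continuous_intros cont c2 c3)
  have c4: "continuous_on {0..t} (\<lambda>s. gs4 (g s))"
    unfolding gs4_def by (intro continuous_intros cont c2 c3 l1) (use nz in auto)
  have c5: "continuous_on {0..t} (\<lambda>s. gs5 (g s))"
    unfolding gs5_def by (intro continuous_intros cont c1 c4 l2) (use nz in auto)
  have c6: "continuous_on {0..t} (\<lambda>s. gs6 (g s))"
    unfolding gs6_def by (intro continuous_intros cont c4 c5) (use nz in auto)
  have l4: "continuous_on {0..t} (\<lambda>s. len4 (g s))"
    unfolding len4_def by (intro continuous_intros cont c4 c5 c6)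
  have skew: "continuous_on {0..t} (\<lambda>s. skew (g s))"
    unfolding skew_def by (intro continuous_intros cont c2)
  have R33: "continuous_on {0..t} (\<lambda>s. ricci33 (g s))"
    unfolding ricci33_def by (intro continuous_intros cont skew l1 l2 l4) (use nz in auto)

  \<comment> \<open>These are \<open>-2\<close> times the coefficients of \<open>g s x1 x3\<close>
    and \<open>g s x2 x3\<close> in \<open>ricci_third\<close> after \<open>skew\<close> is
    expanded. The quantities \<open>gs2\<close>, \<open>len1\<close>, \<open>len2\<close>,
    \<open>len4\<close> and \<open>ricci33\<close> count as given functions of time.\<close>
  let ?p = "\<lambda>s. - 2 * (9 / (8 * len4 (g s))
    + gs2 (g s) * (3/2) * len2 (g s) / (len1 (g s) * (2 * len4 (g s))) + ricci33 (g s) / g s x3 x3)"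
  let ?q = "\<lambda>s. - 2 * (- 3 * (1 - 3/2 * gs2 (g s)) / (4 * len4 (g s))
    - gs2 (g s) * (((1 - 3/2 * gs2 (g s)) * len2 (g s) / len1 (g s) + 9/4) / (2 * len4 (g s))))"
  let ?r = "\<lambda>s. 3 * len2 (g s) / (len1 (g s) * (2 * len4 (g s)))"
  let ?s = "\<lambda>s. - 2 * (((1 - 3/2 * gs2 (g s)) * len2 (g s) / len1 (g s) + 9/4) / (2 * len4 (g s))
    + ricci33 (g s) / g s x3 x3)"
  have "g s x1 x3 = 0 \<and> g s x2 x3 = 0" if "s \<in> {0..t}" for s
  proof (rule linear_ode_zero[of t "\<lambda>s. g s x1 x3" ?p ?q "\<lambda>s. g s x2 x3" ?r ?s, OF _ _ _ _ _ _ _ _ that])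
    fix s assume s: "s \<in> {0..t}"
    have "- 2 * ricci br (g s) x1 x3 = ?p s * g s x1 x3 + ?q s * g s x2 x3"
      using nz[OF s] unfolding ricci_third[OF inner[OF s]] skew_def
      by (simp add: divide_simps) (simp add: algebra_simps)
    then show "((\<lambda>s. g s x1 x3) has_real_derivative ?p s * g s x1 x3 + ?q s * g s x2 x3) (at s within {0..t})"
      using der[OF s, of x1 x3] by (simp only:)
    have "- 2 * ricci br (g s) x2 x3 = ?r s * g s x1 x3 + ?s s * g s x2 x3"
      using nz[OF s] unfolding ricci_third[OF inner[OF s]] skew_def
      by (simp add: divide_simps) (simp add: algebra_simps)
    then show "((\<lambda>s. g s x2 x3) has_real_derivative ?r s * g s x1 x3 + ?s s * g s x2 x3) (at s within {0..t})"
      using der[OF s, of x2 x3] by (simp only:)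
  qed (use nz init g0 in \<open>auto intro!: continuous_intros cont c2 l1 l2 l4 R33\<close>)
  then have third: "g s x1 x3 = 0" "g s x2 x3 = 0" if "s \<in> {0..t}" for s
    using that by auto

  have scalar: "g s x y = 0"
    if ric: "\<And>s. s \<in> {0..t} \<Longrightarrow> ricci br (g s) x y = g s x y * k s"
      and k: "continuous_on {0..t} k" and 0: "g0 x y = 0" and s: "s \<in> {0..t}" for s x y k
  proof -
    \<comment> \<open>The scalar equation is treated as a planar system whose second unknown is
      constantly zero.\<close>
    have "g s x y = 0 \<and> (0::real) = 0"
    proof (rule linear_ode_zero[where x = "\<lambda>s. g s x y" and p = "\<lambda>s. - 2 * k s" and q = "\<lambda>_. 0"
          and y = "\<lambda>_. 0" and r = "\<lambda>_. 0" and s = "\<lambda>_. 0", OF _ _ _ _ _ _ _ _ s])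
      show "((\<lambda>s. g s x y) has_real_derivative - 2 * k s * g s x y + 0 * 0) (at s within {0..t})"
        if "s \<in> {0..t}" for s
        using der[OF that, of x y] by (simp add: ric[OF that] mult.commute mult.left_commute)
    qed (auto simp: init 0 intro!: continuous_intros k)
    then show ?thesis by simp
  qed
  have k: "continuous_on {0..t} (\<lambda>s. len2 (g s) / (2 * len1 (g s) * len4 (g s)))"
    by (intro continuous_intros l1 l2 l4) (use nz in auto)
  have k': "continuous_on {0..t} (\<lambda>s. - len2 (g s) / (2 * len1 (g s) * len4 (g s)))"
    by (intro continuous_intros l1 l2 l4) (use nz in auto)
  have 12: "g s x1 x2 = 0" if "s \<in> {0..t}" for s
    by (rule scalar[OF ricci_12 k g0(1) that]) (simp_all add: inner third)
  have "g s x1 x4 = 0" if "s \<in> {0..t}" for s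
    by (rule scalar[OF ricci_fourth(1) k' g0(3) that]) (simp_all add: inner third 12)
  moreover have "g s x2 x4 = 0" if "s \<in> {0..t}" for s
    by (rule scalar[OF ricci_fourth(2) k g0(5) that]) (simp_all add: inner third 12)
  moreover have "g s x3 x4 = 0" if "s \<in> {0..t}" for s
    by (rule scalar[OF _ continuous_on_const g0(6) that, of 0])
      (simp add: ricci_fourth(3) inner third 12)
  ultimately show "g t x1 x2 = 0" "g t x1 x3 = 0" "g t x1 x4 = 0" "g t x2 x3 = 0" "g t x2 x4 = 0"
    "g t x3 x4 = 0"
    using third 12 t by auto
qed

end

section \<open>Necessity of the condition, and the equivalence\<close>

text \<open>The first entry is a nonzero multiple of \<open>w\<close>; once \<open>w = 0\<close>,
  the second is a nonzero multiple of \<open>v\<close>.\<close>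

lemma (in solvable_frame) ricci_diagonal_imp:
  assumes "ricci br g f1 f3 = 0" "ricci br g f2 f3 = 0"
  shows "v = 0 \<and> w = 0"
  using assms pos unfolding ricci_frame by simp

text \<open>A function that vanishes on an initial interval has one-sided derivative zero at
  \<open>0\<close>, where the flow equation prescribes \<open>- 2 * ricci br g0 x y\<close>.\<close>

lemma ricci_zero_of_remains_zero:
  assumes flow: "ricci_flow_on br g0 g T"
    and zero: "\<And>t. 0 \<le> t \<Longrightarrow> ereal t < T \<Longrightarrow> g t x y = 0"
  shows "ricci br g0 x y = 0"
proof -
  have T: "0 < T" and g0: "g 0 = g0" using flow by (auto simp: ricci_flow_on_def)
  \<comment> \<open>A nondegenerate real interval inside the domain, also when \<open>T\<close> is
    infinite; \<open>0\<close> is a limit point of it, which makes the one-sided derivative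
    unique.\<close>
  obtain \<tau> where \<tau>: "0 < ereal \<tau>" "ereal \<tau> < T"
    using ereal_dense2[OF T] by blast
  have sub: "{0..\<tau>} \<subseteq> {s. 0 \<le> s \<and> ereal s < T}"
    using \<tau>(2) le_less_trans[of "ereal _" "ereal \<tau>" T] by auto
  have "((\<lambda>s. g s x y) has_real_derivative - 2 * ricci br g0 x y)
      (at 0 within {s. 0 \<le> s \<and> ereal s < T})"
    using flow T unfolding ricci_flow_on_def zero_ereal_def by auto
  then have "((\<lambda>s. g s x y) has_real_derivative - 2 * ricci br g0 x y) (at 0 within {0..\<tau>})"
    using sub by (rule DERIV_subset)
  then have "((\<lambda>_. 0) has_real_derivative - 2 * ricci br g0 x y) (at 0 within {0..\<tau>})"
    by (rule has_field_derivative_transform_within[of _ _ _ _ 1]) (use sub \<tau> zero in auto)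
  moreover have "((\<lambda>_. 0) has_real_derivative 0) (at 0 within {0..\<tau>})"
    by simp
  ultimately have "- 2 * ricci br g0 x y = 0"
    using \<tau> by (intro vector_derivative_unique_within[where x = 0 and S = "{0..\<tau>}"])
      (auto simp: at_within_Icc_at_right trivial_limit_at_right_real
        simp flip: has_real_derivative_iff_has_vector_derivative)
  then show ?thesis by simp
qed

theorem proposition4:
  fixes br :: "'a::real_vector \<Rightarrow> 'a \<Rightarrow> 'a"
    and X Y :: "nat \<Rightarrow> 'a"
    and a lam :: "nat \<Rightarrow> real"
    and g0 :: "'a \<Rightarrow> 'a \<Rightarrow> real"
    and g :: "real \<Rightarrow> 'a \<Rightarrow> 'a \<Rightarrow> real"
    and T :: ereal
  assumes "lie_bracket br"
    and "inj_on X {1..4}" and "is_basis (X ` {1..4})"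
    and "br (X 2) (X 3) = 0" and "br (X 3) (X 1) = 0" and "br (X 1) (X 2) = 0"
    and "br (X 1) (X 4) = - (1/2) *\<^sub>R X 1 + X 2"
    and "br (X 2) (X 4) = - (1/2) *\<^sub>R X 2"
    and "br (X 3) (X 4) = X 3"
    and "Y 1 = X 1 + a 2 *\<^sub>R X 2 + a 3 *\<^sub>R X 3"
    and "Y 2 = X 2 + a 1 *\<^sub>R X 3"
    and "Y 3 = X 3"
    and "Y 4 = a 4 *\<^sub>R X 1 + a 5 *\<^sub>R X 2 + a 6 *\<^sub>R X 3 + X 4"
    and "inner_product g0"
    and "\<forall>i\<in>{1..4}. lam i > 0"
    and "\<forall>i\<in>{1..4}. \<forall>j\<in>{1..4}. g0 (Y i) (Y j) = (if i = j then lam i else 0)"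
    and "maximal_ricci_flow br g0 g T"
  shows "remains_diagonal g T Y {1..4} \<longleftrightarrow> a 1 = 0 \<and> a 3 = 0"
proof -
  have I: "{1..4} = {1, 2, 3, 4::nat}" by auto
  have inj: "X 1 \<noteq> X 2" "X 1 \<noteq> X 3" "X 1 \<noteq> X 4" "X 2 \<noteq> X 3" "X 2 \<noteq> X 4" "X 3 \<noteq> X 4"
    using inj_on_eq_iff[OF assms(2)] by auto
  have basis: "independent {X 1, X 2, X 3, X 4}" "span {X 1, X 2, X 3, X 4} = UNIV"
    using assms(3) unfolding is_basis_def I by auto
  interpret L: solvable_lie_algebra br "X 1" "X 2" "X 3" "X 4"
  proof unfold_locales
    fix c1 c2 c3 c4
    assume 0: "c1 *\<^sub>R X 1 + c2 *\<^sub>R X 2 + c3 *\<^sub>R X 3 + c4 *\<^sub>R X 4 = 0"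
    \<comment> \<open>Turns the four coefficients into a function on vectors; distinctness of the
      \<open>X i\<close> ensures that each coefficient is attained.\<close>
    define u where "u x = (if x = X 1 then c1 else if x = X 2 then c2 else if x = X 3 then c3 else c4)" for x
    have "(\<Sum>x\<in>{X 1, X 2, X 3, X 4}. u x *\<^sub>R x) = 0"
      using 0 inj by (simp add: u_def add.assoc)
    then have "\<forall>x\<in>{X 1, X 2, X 3, X 4}. u x = 0"
      using basis(1) dependent_finite[of "{X 1, X 2, X 3, X 4}"] by auto
    then show "c1 = 0 \<and> c2 = 0 \<and> c3 = 0 \<and> c4 = 0"
      using inj by (auto simp: u_def)
  next
    show "br (X 1) (X 3) = 0"
      using lie_bracket_anti[OF assms(1), of "X 1" "X 3"] assms(5) by simp
  qed (use assms basis in auto)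
  note Y = assms(10-13)
  have flow: "ricci_flow_on br g0 g T"
    using assms(17) by (simp add: maximal_ricci_flow_def)
  have diag: "g0 (Y 1) (Y 2) = 0" "g0 (Y 1) (Y 3) = 0" "g0 (Y 1) (Y 4) = 0" "g0 (Y 2) (Y 3) = 0"
    "g0 (Y 2) (Y 4) = 0" "g0 (Y 3) (Y 4) = 0"
    using assms(16) by simp_all
  show ?thesis
  proof
    assume rem: "remains_diagonal g T Y {1..4}"
    have zero: "g t (Y i) (Y 3) = 0" if "0 \<le> t" "ereal t < T" "i \<in> {1, 2}" for t i
      using rem that unfolding remains_diagonal_def by fastforce
    interpret F: solvable_frame br g0 "Y 1" "Y 2" "Y 3" "Y 4" "g0 (Y 1) (Y 1)" "g0 (Y 2) (Y 2)"
      "g0 (Y 3) (Y 3)" "g0 (Y 4) (Y 4)" "3/2 * a 1" "3/2 * a 3 - a 1"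
      by (rule L.solvable_frame_change[OF Y assms(14) diag])
    show "a 1 = 0 \<and> a 3 = 0"
      using F.ricci_diagonal_imp ricci_zero_of_remains_zero[OF flow zero] by simp
  next
    assume "a 1 = 0 \<and> a 3 = 0"
    then interpret M: solvable_lie_algebra br "Y 1" "Y 2" "Y 3" "Y 4"
      by (intro L.solvable_lie_algebra_change[OF Y]) auto
    \<comment> \<open>Symmetry supplies the pairs with \<open>i > j\<close>.\<close>
    have "g t y x = g t x y" if "0 \<le> t" "ereal t < T" for t x y
      using flow that by (simp add: ricci_flow_on_def inner_product_def)
    then show "remains_diagonal g T Y {1..4}"
      unfolding remains_diagonal_def I using M.flow_remains_diagonal[OF flow _ _ diag]
      by auto
  qed
qed

end
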